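(* Let $r,n\ge 1$ be integers and let $\omega$ be a primitive $r$th root of unity. For all $a\in\{0,1\}$ and $b\in\{0,1,\dots,r-1\}$, $$\sum_{\pi\in G(r,n)} \chi_{a,b}(\pi)\,q^{\mathrm{sor}(\pi)} = \prod_{k=1}^n \left( 1 + (-1)^a[k-1]_q\left( q + \omega^{br}q^k[r-1]_q \right) + \omega^b q^{2k-1}[r-1]_{\omega^b q} \right).$$
   Context: For an integer $m\ge 0$ and any quantity $p$, $[m]_p:=1+p+p^2+\cdots+p^{m-1}$ (so $[0]_p=0$). $G(r,n)=C_r\wr\mathfrak S_n$ is the group of $r$-colored permutations. An element is a word $\pi=\pi_1\cdots\pi_n=\sigma_1^{[z_1]}\cdots\sigma_n^{[z_n]}$ with $\sigma\in\mathfrak S_n$ and colors $z_i\in\{0,1,\dots,r-1\}$ (representing $\mathbb Z_r$); we write $|\pi_i|=\sigma_i$ and $i^{[0]}=i$. It is identified with the bijection of $\{i^{[t]}:1\le i\le n,\ t\in\mathbb Z_r\}$ given by $\pi(i^{[t]})=\sigma_i^{[z_i+t]}$, and multiplication is composition, $(\pi\rho)(x)=\pi(\rho(x))$. The group is generated by $\mathcal S=\{s_0,s_1,\dots,s_{n-1}\}$, where $s_i$ ($i\ge1$) is the transposition exchanging $i$ and $i+1$, and $s_0$ maps $1\mapsto 1^{[1]}$ and fixes $2,\dots,n$. $\ell(\pi)$ is the length of $\pi$ with respect to $\mathcal S$, i.e. the minimal number of factors in an expression of $\pi$ as a product of elements of $\mathcal S$. Equivalently (Bagno), $\ell(\pi)=\mathrm{inv}(\pi)+\sum_{i:\,z_i>0}(|\pi_i|+z_i-1)$,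 where $\mathrm{inv}(\pi)=|\{(i,j): i<j,\ \pi_i>\pi_j\}|$ with respect to the linear order $(n^{[r-1]}<\cdots<n^{[1]})<\cdots<(1^{[r-1]}<\cdots<1^{[1]})<(1<\cdots<n)$. Put $\mathrm{col}(\pi):=\sum_{i=1}^n z_i$ (an integer sum). The one-dimensional characters are $$\chi_{a,b}(\pi)=(-1)^{a(\ell(\pi)-\mathrm{col}(\pi))}\,\omega^{b\,\mathrm{col}(\pi)},\qquad a\in\{0,1\},\ b\in\{0,\dots,r-1\}.$$ Transpositions: for $1\le i<j\le n$ and $0\le t<r$, $(i^{[t]},j)\in G(r,n)$ is the element such that multiplying $\pi=\sigma_1^{[z_1]}\cdots\sigma_n^{[z_n]}$ on the right by it replaces $\pi_j$ by $\sigma_i^{[z_i+t]}$ and $\pi_i$ by $\sigma_j^{[z_j-t]}$ (colors mod $r$), leaving the other entries unchanged. For $1\le i\le n$ and $0<t<r$, $(i^{[t]},i)$ is the element such that multiplying $\pi$ on the right by it replaces $\pi_i$ by $\sigma_i^{[z_i+t]}$. Every $\pi\in G(r,n)$ has a unique expression as a product of such transpositions $$\pi=(i_1^{[t_1]},j_1)(i_2^{[t_2]},j_2)\cdots(i_m^{[t_m]},j_m),\qquad 0<j_1<j_2<\cdots<j_m,$$ for some $m\ge 0$. The sorting index is $$\mathrm{sor}(\pi):=\sum_{s=1}^m\Big(j_s-i_s+\delta(t_s>0)\cdot\big(2(i_s-1)+t_s\big)\Big),$$ where $\delta(\mathsf A)=1$ if $\mathsf A$ is true and $0$ otherwise. 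*)

theory Defs
  imports Complex_Main "HOL-Combinatorics.Permutations" "HOL-Computational_Algebra.Polynomial"
begin

definition qint :: "nat \<Rightarrow> 'a::comm_semiring_1 \<Rightarrow> 'a" where
  "qint m p = (\<Sum>i<m. p ^ i)"

definition primitive_root_of_unity :: "nat \<Rightarrow> complex \<Rightarrow> bool" where
  "primitive_root_of_unity r w \<longleftrightarrow> r \<ge> 1 \<and> w ^ r = 1 \<and> (\<forall>k. 1 \<le> k \<and> k < r \<longrightarrow> w ^ k \<noteq> 1)"

text \<open>
  The colored letter i with color t is the pair (i, t), where colors are represented by
  0, ..., r - 1. The word with letters \<open>\<sigma> i\<close> of color \<open>z i\<close> is the map below, extended by the
  identity outside the set of colored letters, so that group multiplication is composition
  of functions. Each \<open>z i\<close> only matters modulo r.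
\<close>

type_synonym cmap = "nat \<times> nat \<Rightarrow> nat \<times> nat"

definition cperm :: "nat \<Rightarrow> nat \<Rightarrow> (nat \<Rightarrow> nat) \<Rightarrow> (nat \<Rightarrow> nat) \<Rightarrow> cmap" where
  "cperm r n \<sigma> z = (\<lambda>(i, t). if i \<in> {1..n} \<and> t < r then (\<sigma> i, (z i + t) mod r) else (i, t))"

definition colored_perms :: "nat \<Rightarrow> nat \<Rightarrow> cmap set" where
  "colored_perms r n = {cperm r n \<sigma> z | \<sigma> z. \<sigma> permutes {1..n} \<and> (\<forall>i\<in>{1..n}. z i < r)}"

definition cprod :: "cmap list \<Rightarrow> cmap" where
  "cprod ps = foldr (\<circ>) ps id"

definition col :: "nat \<Rightarrow> cmap \<Rightarrow> nat" where
  "col n \<pi> = (\<Sum>i=1..n. snd (\<pi> (i, 0)))"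

definition simple_gen :: "nat \<Rightarrow> nat \<Rightarrow> nat \<Rightarrow> cmap" where
  "simple_gen r n i =
     (if i = 0 then cperm r n id (\<lambda>k. if k = 1 then 1 else 0)
      else cperm r n (transpose i (Suc i)) (\<lambda>_. 0))"

definition clength :: "nat \<Rightarrow> nat \<Rightarrow> cmap \<Rightarrow> nat" where
  "clength r n \<pi> =
     (LEAST k. \<exists>ws. length ws = k \<and> set ws \<subseteq> simple_gen r n ` {0..<n} \<and> cprod ws = \<pi>)"

text \<open>The exponent of -1 is an integer difference, hence \<open>powi\<close>.\<close>

definition chi :: "nat \<Rightarrow> nat \<Rightarrow> complex \<Rightarrow> nat \<Rightarrow> nat \<Rightarrow> cmap \<Rightarrow> complex" where
  "chi r n \<omega> a b \<pi> =
     (-1) powi (int a * (int (clength r n \<pi>) - int (col n \<pi>))) * \<omega> ^ (b * col n \<pi>)"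

text \<open>
  The element \<open>ctransp r n i t j\<close> sends (j, 0) to (i, t) and, if \<open>i < j\<close>, (i, 0) to (j, -t mod r);
  right multiplication by it therefore replaces entry j of a word by entry i with its color raised
  by t, and (if \<open>i < j\<close>) entry i by entry j with its color lowered by t. For \<open>i = j\<close> the
  transposition is the identity permutation and only the color of entry j changes.
\<close>

definition ctransp :: "nat \<Rightarrow> nat \<Rightarrow> nat \<Rightarrow> nat \<Rightarrow> nat \<Rightarrow> cmap" where
  "ctransp r n i t j =
     cperm r n (transpose i j) (\<lambda>k. if k = j then t else if k = i then (r - t) mod r else 0)"

text \<open>A triple (i, t, j) in the list stands for the factor \<open>ctransp r n i t j\<close>.\<close>

definition sorting_factorization :: "nat \<Rightarrow> nat \<Rightarrow> cmap \<Rightarrow> (nat \<times> nat \<times> nat) list \<Rightarrow> bool" where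
  "sorting_factorization r n \<pi> fs \<longleftrightarrow>
     (\<forall>(i, t, j) \<in> set fs. 1 \<le> i \<and> i \<le> j \<and> j \<le> n \<and> t < r \<and> (i = j \<longrightarrow> 0 < t)) \<and>
     sorted_wrt (<) (map (\<lambda>(i, t, j). j) fs) \<and>
     cprod (map (\<lambda>(i, t, j). ctransp r n i t j) fs) = \<pi>"

text \<open>Every colored permutation has exactly one sorting factorization, so \<open>THE\<close> is well defined.\<close>

definition sor :: "nat \<Rightarrow> nat \<Rightarrow> cmap \<Rightarrow> nat" where
  "sor r n \<pi> =
     (\<Sum>(i, t, j) \<leftarrow> (THE fs. sorting_factorization r n \<pi> fs).
        j - i + (if t > 0 then 2 * (i - 1) + t else 0))"

end

theory Submission
  imports Defs
begin

text \<open>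
  The sorting factorization turns the group into a product of small sets. The last factor of
  \<open>\<pi>\<close> is dictated by the colored letter that \<open>\<pi>\<close> sends to the largest letter, and
  stripping it leaves an element of the next smaller group. Adjoining a trivial factor
  \<open>(n + 1, 0, n + 1)\<close> for the case in which nothing has to be sorted, the map
  \<open>(\<rho>, i, t) \<mapsto> \<rho> \<circ> ctransp r (n + 1) i t (n + 1)\<close> is a bijection from
  \<open>G(r, n) \<times> {1..n + 1} \<times> {..<r}\<close> onto \<open>G(r, n + 1)\<close> (\<open>bij_betw_colored_perms_Suc\<close>).
  The sorting index is additive along it (\<open>sor_comp_ctransp\<close>).

  A character is multiplicative, so the generating function gains, at each step, the factor
  \<open>\<Sum>i t. \<chi>(ctransp r k i t k) q^(weight of the factor)\<close>. For \<open>i < k\<close> the character of the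
  factor is \<open>(-1)^a\<close>, because it is a transposition whose two colors cancel modulo \<open>r\<close>; for
  \<open>i = k\<close> it is \<open>\<omega>^(b t)\<close>. Summing geometric series gives the \<open>k\<close>-th factor of the
  product (\<open>sum_last_factor\<close>).

  What needs an argument is that \<open>chi\<close>, defined through the word length, is multiplicative at
  all. For odd \<open>r\<close> the parity of the length of a word is not determined by its product, since
  \<open>s_0^r\<close> is a relation of odd length, so minimality has to enter. In a word, each occurrence
  of \<open>s_0\<close> raises the color of one particular letter by one. If a letter is raised
  \<open>r\<close> times or more, deleting \<open>r\<close> of these occurrences changes neither the
  permutation nor the colors. Hence in a minimal word every letter is raised exactly as often as its final
  color says, \<open>s_0\<close> occurs \<open>col \<pi>\<close> times, and length minus \<open>col\<close>
  counts the adjacent transpositions, whose parity is the sign of the underlying permutation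
  (\<open>chi_eq_sign\<close>).
\<close>

section \<open>The wreath product\<close>

lemma cperm_cong:
  assumes "\<And>k. k \<in> {1..n} \<Longrightarrow> \<sigma> k = \<sigma>' k" and "\<And>k. k \<in> {1..n} \<Longrightarrow> z k mod r = z' k mod r"
  shows "cperm r n \<sigma> z = cperm r n \<sigma>' z'"
proof
  fix x :: "nat \<times> nat"
  obtain k t where x: "x = (k, t)" by force
  show "cperm r n \<sigma> z x = cperm r n \<sigma>' z' x"
  proof (cases "k \<in> {1..n} \<and> t < r")
    case True
    then have "(z k + t) mod r = (z' k + t) mod r"
      using assms(2) by (intro mod_add_cong) auto
    then show ?thesis using True assms(1) by (simp add: x cperm_def)
  next
    case False
    then show ?thesis unfolding x cperm_def by (simp only: prod.case if_False)
  qed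
qed

text \<open>
  Colors add without reduction modulo \<open>r\<close>, because \<open>cperm\<close> reduces them anyway. This is
  why colorings are kept as arbitrary functions into the naturals in what follows.
\<close>

lemma cperm_comp:
  assumes "\<tau> permutes {1..n}"
  shows "cperm r n \<sigma> y \<circ> cperm r n \<tau> z = cperm r n (\<sigma> \<circ> \<tau>) (\<lambda>k. y (\<tau> k) + z k)"
proof
  fix x :: "nat \<times> nat"
  obtain k t where x: "x = (k, t)" by force
  have "\<tau> k \<in> {1..n} \<longleftrightarrow> k \<in> {1..n}" by (rule permutes_in_image[OF assms])
  then show "(cperm r n \<sigma> y \<circ> cperm r n \<tau> z) x = cperm r n (\<sigma> \<circ> \<tau>) (\<lambda>k. y (\<tau> k) + z k) x"
    by (auto simp: x cperm_def mod_add_right_eq add.assoc)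
qed

lemma cperm_id: "cperm r n id (\<lambda>_. 0) = id"
  by (auto simp: cperm_def)

lemma cperm_in_colored_perms:
  assumes "r \<ge> 1" "\<sigma> permutes {1..n}"
  shows "cperm r n \<sigma> z \<in> colored_perms r n"
proof -
  have "cperm r n \<sigma> z = cperm r n \<sigma> (\<lambda>k. z k mod r)"
    by (rule cperm_cong) auto
  moreover have "z k mod r < r" for k using assms(1) by simp
  ultimately show ?thesis unfolding colored_perms_def using assms(2) by blast
qed

lemma colored_permsE:
  assumes "\<pi> \<in> colored_perms r n"
  obtains \<sigma> z where "\<sigma> permutes {1..n}" "\<And>k. k \<in> {1..n} \<Longrightarrow> z k < r" "\<pi> = cperm r n \<sigma> z"
  using assms unfolding colored_perms_def by blast

lemma colored_perms_comp:
  assumes "r \<ge> 1" "\<pi> \<in> colored_perms r n" "\<rho> \<in> colored_perms r n"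
  shows "\<pi> \<circ> \<rho> \<in> colored_perms r n"
proof -
  obtain \<sigma> y \<tau> z where "\<sigma> permutes {1..n}" "\<pi> = cperm r n \<sigma> y"
    and "\<tau> permutes {1..n}" "\<rho> = cperm r n \<tau> z"
    using assms(2,3) by (elim colored_permsE)
  then show ?thesis
    by (simp add: cperm_comp cperm_in_colored_perms assms(1) permutes_compose del: One_nat_def)
qed

lemma cperm_Suc:
  assumes "\<sigma> permutes {1..n}"
  shows "cperm r n \<sigma> z = cperm r (Suc n) \<sigma> (z(Suc n := 0))"
  using permutes_not_in[OF assms, of "Suc n"] by (auto simp: cperm_def fun_eq_iff le_Suc_eq)

lemma colored_perms_Suc_mono:
  assumes "r \<ge> 1"
  shows "colored_perms r n \<subseteq> colored_perms r (Suc n)"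
proof
  fix \<pi> assume "\<pi> \<in> colored_perms r n"
  then obtain \<sigma> z where \<sigma>: "\<sigma> permutes {1..n}" and \<pi>: "\<pi> = cperm r n \<sigma> z"
    by (rule colored_permsE)
  have "\<sigma> permutes {1..Suc n}" using \<sigma> by (rule permutes_subset) auto
  then show "\<pi> \<in> colored_perms r (Suc n)"
    using assms unfolding \<pi> cperm_Suc[OF \<sigma>] by (rule cperm_in_colored_perms[rotated])
qed

lemma colored_perms_fix_outside:
  assumes "\<pi> \<in> colored_perms r n" "k \<notin> {1..n}"
  shows "\<pi> (k, t) = (k, t)"
  using assms by (auto elim!: colored_permsE simp: cperm_def)

lemma colored_perms_0: "colored_perms r 0 = {id}"
  by (auto simp: colored_perms_def cperm_def fun_eq_iff)

definition underlying :: "cmap \<Rightarrow> nat \<Rightarrow> nat" where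
  "underlying \<pi> k = fst (\<pi> (k, 0))"

text \<open>
  Letters outside the range are fixed, so reading off the first component of \<open>\<pi> (k, 0)\<close>
  recovers \<open>\<sigma>\<close> as a function on all naturals, not only on \<open>{1..n}\<close>.
\<close>

lemma underlying_cperm:
  assumes "r \<ge> 1" "\<sigma> permutes {1..n}"
  shows "underlying (cperm r n \<sigma> z) = \<sigma>"
  using assms permutes_not_in[OF assms(2)] by (auto simp: underlying_def cperm_def fun_eq_iff)

lemma underlying_permutes:
  assumes "r \<ge> 1" "\<pi> \<in> colored_perms r n"
  shows "underlying \<pi> permutes {1..n}"
  using assms by (metis colored_permsE underlying_cperm)

lemma ctransp_in_colored_perms:
  assumes "r \<ge> 1" "i \<in> {1..n}" "j \<in> {1..n}"
  shows "ctransp r n i t j \<in> colored_perms r n"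
  unfolding ctransp_def using assms by (intro cperm_in_colored_perms permutes_swap_id) auto

lemma ctransp_trivial: "ctransp r n j 0 j = id"
proof -
  have "ctransp r n j 0 j = cperm r n id (\<lambda>_. 0)"
    unfolding ctransp_def by (rule cperm_cong) auto
  then show ?thesis by (simp add: cperm_id)
qed

lemma ctransp_Suc:
  assumes "i \<in> {1..n}" "j \<in> {1..n}"
  shows "ctransp r (Suc n) i t j = ctransp r n i t j"
  unfolding ctransp_def cperm_Suc[OF permutes_swap_id[OF assms]]
  using assms by (intro cperm_cong) auto

text \<open>
  The inverse is written down as a word with the same transposition and the negated colors.
  Surjectivity is what allows cancelling the factor on the right.
\<close>

lemma ctransp_last_surj:
  assumes "r \<ge> 1" "i \<in> {1..n}"
  shows "surj (ctransp r n i t n)"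
proof -
  define y where "y = (\<lambda>k. if k = n then t else if k = i then (r - t) mod r else 0)"
  define s where "s = transpose i n"
  have s: "s permutes {1..n}" unfolding s_def using assms by (intro permutes_swap_id) auto
  have "ctransp r n i t n \<circ> cperm r n s (\<lambda>k. (r - y (s k) mod r))
      = cperm r n (s \<circ> s) (\<lambda>k. y (s k) + (r - y (s k) mod r))"
    unfolding ctransp_def y_def[symmetric] s_def[symmetric] by (rule cperm_comp[OF s])
  also have "\<dots> = cperm r n id (\<lambda>_. 0)"
  proof (rule cperm_cong)
    fix k
    have "(y (s k) + (r - y (s k) mod r)) mod r = (y (s k) mod r + (r - y (s k) mod r)) mod r"
      by (simp add: mod_add_left_eq)
    also have "y (s k) mod r + (r - y (s k) mod r) = r" using assms(1) by simp
    finally show "(y (s k) + (r - y (s k) mod r)) mod r = 0 mod r" by simp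
  qed (simp add: s_def)
  also have "\<dots> = id" by (rule cperm_id)
  finally show ?thesis by (metis comp_apply id_apply surjI)
qed

text \<open>
  The index \<open>i\<close> and the color \<open>t\<close> of the last factor can be read off from the product: \<open>i\<close> is
  the position of the largest letter, and its color determines \<open>t\<close>. The case distinction stems
  from \<open>ctransp\<close>, which raises the color at the last position by \<open>t\<close> but lowers the one at
  position \<open>i\<close> when the two differ.
\<close>

lemma comp_ctransp_at_pivot:
  assumes "r \<ge> 1" "\<rho> \<in> colored_perms r n" "i \<in> {1..Suc n}" "t < r"
  shows "(\<rho> \<circ> ctransp r (Suc n) i t (Suc n)) (i, 0) =
    (Suc n, if i = Suc n then t else (r - t) mod r)"
  using assms colored_perms_fix_outside[OF assms(2)] by (auto simp: ctransp_def cperm_def)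

text \<open>
  Sorting the largest letter into the last place: if it stands at position \<open>i\<close>, exchange the
  entries at \<open>i\<close> and at the end, with \<open>t\<close> chosen so that the color of the largest letter vanishes.
  If \<open>i\<close> is not the last position, the entry displaced to it carries the sum of the two colors.
\<close>

lemma colored_perms_peel_last:
  assumes r: "r \<ge> 1" and \<pi>: "\<pi> \<in> colored_perms r (Suc n)"
  shows "\<exists>\<rho> \<in> colored_perms r n. \<exists>i \<in> {1..Suc n}. \<exists>t<r. \<pi> = \<rho> \<circ> ctransp r (Suc n) i t (Suc n)"
proof -
  from \<pi> obtain \<sigma> z where \<sigma>: "\<sigma> permutes {1..Suc n}" and z: "\<And>k. k \<in> {1..Suc n} \<Longrightarrow> z k < r"
    and \<pi>_eq: "\<pi> = cperm r (Suc n) \<sigma> z" by (rule colored_permsE) blast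
  define i where "i = inv \<sigma> (Suc n)"
  have \<sigma>i: "\<sigma> i = Suc n" unfolding i_def by (simp add: permutes_inverses[OF \<sigma>])
  have i: "i \<in> {1..Suc n}" using permutes_in_image[OF \<sigma>, of i] \<sigma>i by simp
  define t where "t = (if i = Suc n then z i else (r - z i) mod r)"
  define s where "s = transpose i (Suc n)"
  have s: "s permutes {1..Suc n}" unfolding s_def using i by (intro permutes_swap_id) auto
  have \<sigma>s: "(\<sigma> \<circ> s) permutes {1..n}"
  proof (rule permutes_superset)
    show "(\<sigma> \<circ> s) permutes {1..Suc n}" by (rule permutes_compose[OF s \<sigma>])
    fix x assume "x \<in> {1..Suc n} - {1..n}"
    then have "x = Suc n" by auto
    then show "(\<sigma> \<circ> s) x = x" using \<sigma>i by (simp add: s_def)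
  qed
  \<comment> \<open>Setting the last color to 0 makes \<open>y\<close> serve both for \<open>n\<close> and for \<open>Suc n\<close> letters.\<close>
  define y where "y = (z(i := z i + z (Suc n)))(Suc n := 0)"
  have "cperm r n (\<sigma> \<circ> s) y \<circ> ctransp r (Suc n) i t (Suc n)
      = cperm r (Suc n) (\<sigma> \<circ> s \<circ> s)
          (\<lambda>k. y (s k) + (if k = Suc n then t else if k = i then (r - t) mod r else 0))"
    unfolding cperm_Suc[OF \<sigma>s] ctransp_def s_def[symmetric] cperm_comp[OF s]
    by (simp add: y_def)
  also have "\<dots> = \<pi>"
    unfolding \<pi>_eq
  proof (rule cperm_cong)
    show "(\<sigma> \<circ> s \<circ> s) k = \<sigma> k" for k by (simp add: s_def)
    have zi: "z i < r" using z i by simp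
    show "(y (s k) + (if k = Suc n then t else if k = i then (r - t) mod r else 0)) mod r
      = z k mod r" if "k \<in> {1..Suc n}" for k
    proof (cases "z i = 0")
      case True
      then show ?thesis using that i r by (auto simp: y_def s_def t_def transpose_def)
    next
      case False
      then have "(r - z i) mod r = r - z i" using zi by simp
      then show ?thesis using that i r zi False by (auto simp: y_def s_def t_def transpose_def)
    qed
  qed
  finally have eq: "\<pi> = cperm r n (\<sigma> \<circ> s) y \<circ> ctransp r (Suc n) i t (Suc n)" ..
  have "t < r" using z[OF i] r by (auto simp: t_def)
  with eq i cperm_in_colored_perms[OF r \<sigma>s] show ?thesis by blast
qed

lemma colored_perms_peel_last_inj:
  assumes r: "r \<ge> 1"
    and \<rho>: "\<rho> \<in> colored_perms r n" "i \<in> {1..Suc n}" "t < r"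
    and \<rho>': "\<rho>' \<in> colored_perms r n" "i' \<in> {1..Suc n}" "t' < r"
    and eq: "\<rho> \<circ> ctransp r (Suc n) i t (Suc n) = \<rho>' \<circ> ctransp r (Suc n) i' t' (Suc n)"
      (is "?\<pi> = ?\<pi>'")
  shows "\<rho> = \<rho>' \<and> i = i' \<and> t = t'"
proof -
  note at = comp_ctransp_at_pivot[OF r \<rho>] comp_ctransp_at_pivot[OF r \<rho>', folded eq]
  have "?\<pi> \<in> colored_perms r (Suc n)"
    using \<rho> colored_perms_Suc_mono[OF r] by (intro colored_perms_comp ctransp_in_colored_perms r) auto
  then have "inj (underlying ?\<pi>)" using permutes_inj underlying_permutes[OF r] by blast
  moreover have "underlying ?\<pi> i = underlying ?\<pi> i'"
    unfolding underlying_def at by simp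
  ultimately have i: "i = i'" by (rule injD)
  have "(if i = Suc n then t else (r - t) mod r) = (if i = Suc n then t' else (r - t') mod r)"
    using at unfolding i by simp
  then have t: "t = t'"
    using \<rho>(3) \<rho>'(3) by (cases "t = 0"; cases "t' = 0") (auto split: if_splits)
  have "\<rho> = \<rho>'"
  proof
    fix x
    obtain w where "x = ctransp r (Suc n) i t (Suc n) w"
      using ctransp_last_surj[OF r \<rho>(2)] by (metis surjD)
    then show "\<rho> x = \<rho>' x" using fun_cong[OF eq, of w] by (simp add: i t)
  qed
  with i t show ?thesis by blast
qed

text \<open>
  The pair \<open>(Suc n, 0)\<close>, which no sorting factorization may contain, is included here: it yields
  the identity and so accounts for the elements that already fix the last letter.
\<close>

lemma bij_betw_colored_perms_Suc:
  assumes "r \<ge> 1"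
  shows "bij_betw (\<lambda>(\<rho>, i, t). \<rho> \<circ> ctransp r (Suc n) i t (Suc n))
    (colored_perms r n \<times> {1..Suc n} \<times> {..<r}) (colored_perms r (Suc n))"
  unfolding bij_betw_def
proof
  show "inj_on (\<lambda>(\<rho>, i, t). \<rho> \<circ> ctransp r (Suc n) i t (Suc n))
    (colored_perms r n \<times> {1..Suc n} \<times> {..<r})"
  proof (rule inj_onI, elim SigmaE)
    fix x y \<rho> p i t \<rho>' p' i' t'
    assume "(case x of (\<rho>, i, t) \<Rightarrow> \<rho> \<circ> ctransp r (Suc n) i t (Suc n)) =
        (case y of (\<rho>, i, t) \<Rightarrow> \<rho> \<circ> ctransp r (Suc n) i t (Suc n))"
      and "x = (\<rho>, p)" "p = (i, t)" "y = (\<rho>', p')" "p' = (i', t')"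
      and "\<rho> \<in> colored_perms r n" "i \<in> {1..Suc n}" "t \<in> {..<r}"
      and "\<rho>' \<in> colored_perms r n" "i' \<in> {1..Suc n}" "t' \<in> {..<r}"
    then show "x = y"
      using colored_perms_peel_last_inj[OF assms, of \<rho> n i t \<rho>' i' t'] by simp
  qed
  have "\<rho> \<circ> ctransp r (Suc n) i t (Suc n) \<in> colored_perms r (Suc n)"
    if "\<rho> \<in> colored_perms r n" "i \<in> {1..Suc n}" for \<rho> i t
    using that colored_perms_Suc_mono[OF assms]
    by (intro colored_perms_comp ctransp_in_colored_perms assms) auto
  then show "(\<lambda>(\<rho>, i, t). \<rho> \<circ> ctransp r (Suc n) i t (Suc n)) `
      (colored_perms r n \<times> {1..Suc n} \<times> {..<r}) = colored_perms r (Suc n)" (is "?f ` ?D = _")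
  proof (intro equalityI subsetI)
    fix \<pi> assume "\<pi> \<in> colored_perms r (Suc n)"
    then obtain \<rho> i t where "\<rho> \<in> colored_perms r n" "i \<in> {1..Suc n}" "t < r"
      and "\<pi> = ?f (\<rho>, i, t)"
      using colored_perms_peel_last[OF assms] by (metis case_prod_conv)
    then show "\<pi> \<in> ?f ` ?D" by (intro image_eqI[of _ _ "(\<rho>, i, t)"]) auto
  qed auto
qed

section \<open>Sorting factorizations and the sorting index\<close>

definition factor_weight :: "nat \<Rightarrow> nat \<Rightarrow> nat \<Rightarrow> nat" where
  "factor_weight i t j = j - i + (if t > 0 then 2 * (i - 1) + t else 0)"

lemma cprod_Nil: "cprod [] = id"
  by (simp add: cprod_def)

lemma cprod_Cons: "cprod (p # ps) = p \<circ> cprod ps"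
  by (simp add: cprod_def)

lemma cprod_append: "cprod (ps @ qs) = cprod ps \<circ> cprod qs"
  by (induction ps) (auto simp: cprod_def)

lemma sorting_factorization_0: "sorting_factorization r 0 \<pi> fs \<longleftrightarrow> fs = [] \<and> \<pi> = id"
  by (cases fs) (auto simp: sorting_factorization_def cprod_def)

lemma sorting_factorization_bound:
  assumes "sorting_factorization r n \<pi> fs" "(i, t, j) \<in> set fs"
  shows "1 \<le> i" "i \<le> j" "j \<le> n" "t < r" "i = j \<Longrightarrow> 0 < t"
  using assms by (auto simp: sorting_factorization_def)

text \<open>
  The number of letters is a parameter of \<open>ctransp\<close>, yet a factor whose larger index is at most
  \<open>n\<close> is the same map for \<open>n\<close> and for \<open>Suc n\<close> letters. Hence factorizations pass between
  consecutive groups.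
\<close>

lemma sorting_factorization_Suc_iff:
  assumes "\<And>i t j. (i, t, j) \<in> set fs \<Longrightarrow> j \<le> n"
  shows "sorting_factorization r (Suc n) \<pi> fs \<longleftrightarrow> sorting_factorization r n \<pi> fs"
proof -
  define valid where "valid m \<longleftrightarrow>
    (\<forall>(i, t, j) \<in> set fs. 1 \<le> i \<and> i \<le> j \<and> j \<le> m \<and> t < r \<and> (i = j \<longrightarrow> 0 < t))" for m
  have valid: "valid (Suc n) \<longleftrightarrow> valid n"
    unfolding valid_def by (intro ball_cong refl) (use assms in \<open>auto intro: le_SucI\<close>)
  have valid_map: "map (\<lambda>(i, t, j). ctransp r (Suc n) i t j) fs = map (\<lambda>(i, t, j). ctransp r n i t j) fs"
    if "valid n"
  proof (rule map_cong[OF refl])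
    fix f assume f: "f \<in> set fs"
    obtain i t j where "f = (i, t, j)" by (cases f)
    with that f show "(\<lambda>(i, t, j). ctransp r (Suc n) i t j) f = (\<lambda>(i, t, j). ctransp r n i t j) f"
      by (auto simp: valid_def intro!: ctransp_Suc)
  qed
  show ?thesis
    unfolding sorting_factorization_def valid_def[symmetric] valid
    by (intro conj_cong refl) (simp only: valid_map)
qed

lemma sorting_factorization_lift:
  assumes "sorting_factorization r n \<rho> fs"
  shows "sorting_factorization r (Suc n) \<rho> fs"
  using assms by (rule sorting_factorization_Suc_iff[THEN iffD2, rotated])
    (rule sorting_factorization_bound(3)[OF assms])

lemma sorting_factorization_snoc:
  assumes "sorting_factorization r n \<rho> fs" "i \<in> {1..Suc n}" "t < r" "i = Suc n \<longrightarrow> 0 < t"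
  shows "sorting_factorization r (Suc n) (\<rho> \<circ> ctransp r (Suc n) i t (Suc n)) (fs @ [(i, t, Suc n)])"
proof -
  have "\<forall>j \<in> set (map (\<lambda>(i, t, j). j) fs). j < Suc n"
    using assms(1) by (auto simp: sorting_factorization_def)
  with sorting_factorization_lift[OF assms(1)] assms(2-4) show ?thesis
    by (auto simp: sorting_factorization_def sorted_wrt_append cprod_append cprod_Cons cprod_Nil)
qed

text \<open>
  Because the larger indices increase strictly, only the last factor can involve \<open>Suc n\<close>. A
  factorization without such a factor is treated as one whose last factor is the trivial
  \<open>(Suc n, 0, Suc n)\<close>, which merges both cases into the parametrization of
  \<open>bij_betw_colored_perms_Suc\<close>.
\<close>

lemma sorting_factorization_unsnoc:
  assumes "sorting_factorization r (Suc n) \<pi> fs" "r \<ge> 1"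
  obtains \<rho> gs i t where "sorting_factorization r n \<rho> gs" "i \<in> {1..Suc n}" "t < r"
    "\<pi> = \<rho> \<circ> ctransp r (Suc n) i t (Suc n)"
    "fs = gs @ (if i = Suc n \<and> t = 0 then [] else [(i, t, Suc n)])"
proof -
  show ?thesis
  proof (cases "\<forall>(i, t, j) \<in> set fs. j \<le> n")
    case True
    show ?thesis
    proof (rule that)
      show "sorting_factorization r n \<pi> fs"
        using assms(1) by (rule sorting_factorization_Suc_iff[THEN iffD1, rotated]) (use True in auto)
    qed (use assms(2) in \<open>auto simp: ctransp_trivial\<close>)
  next
    case False
    then have "fs \<noteq> []" by auto
    then obtain gs i t j where fs: "fs = gs @ [(i, t, j)]"
      by (metis append_butlast_last_id prod_cases3)
    have before: "j' < j" if "(i', t', j') \<in> set gs" for i' t' j'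
    proof -
      have "sorted_wrt (<) (map (\<lambda>(i, t, j). j) gs @ [j])"
        using assms(1) by (simp add: sorting_factorization_def fs)
      moreover have "j' \<in> set (map (\<lambda>(i, t, j). j) gs)"
        using that by (force simp: image_iff)
      ultimately show ?thesis unfolding sorted_wrt_append by auto
    qed
    have it: "1 \<le> i" "i \<le> j" "j \<le> Suc n" "t < r" "i = j \<Longrightarrow> 0 < t"
      using sorting_factorization_bound[OF assms(1), of i t j] by (simp_all add: fs)
    obtain i' t' j' where "(i', t', j') \<in> set fs" "\<not> j' \<le> n" using False by blast
    then have j: "j = Suc n"
      using it(3) before[of i' t' j'] by (auto simp: fs)
    let ?\<rho> = "cprod (map (\<lambda>(i, t, j). ctransp r (Suc n) i t j) gs)"
    have "cprod (map (\<lambda>(i, t, j). ctransp r (Suc n) i t j) fs) = \<pi>"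
      using assms(1) by (simp add: sorting_factorization_def)
    then have \<pi>: "\<pi> = ?\<rho> \<circ> ctransp r (Suc n) i t (Suc n)"
      by (simp add: fs cprod_append cprod_Cons cprod_Nil j)
    have "sorting_factorization r (Suc n) ?\<rho> gs"
      using assms(1) by (simp add: sorting_factorization_def fs sorted_wrt_append)
    then have "sorting_factorization r n ?\<rho> gs"
      by (rule sorting_factorization_Suc_iff[THEN iffD1, rotated])
        (use before j in \<open>auto simp: less_Suc_eq_le\<close>)
    then show ?thesis
      by (rule that) (use it j \<pi> fs in auto)
  qed
qed

lemma sorting_factorization_in_colored_perms:
  assumes "r \<ge> 1"
  shows "sorting_factorization r n \<pi> fs \<Longrightarrow> \<pi> \<in> colored_perms r n"
proof (induction n arbitrary: \<pi> fs)
  case 0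
  then show ?case unfolding sorting_factorization_0 colored_perms_0 by blast
next
  case (Suc n)
  then obtain \<rho> gs i t where "sorting_factorization r n \<rho> gs" "i \<in> {1..Suc n}"
    and \<pi>: "\<pi> = \<rho> \<circ> ctransp r (Suc n) i t (Suc n)"
    using assms by (blast elim: sorting_factorization_unsnoc)
  then have "\<rho> \<in> colored_perms r n" by (blast intro: Suc.IH)
  then show ?case unfolding \<pi> using \<open>i \<in> {1..Suc n}\<close> colored_perms_Suc_mono[OF assms]
    by (intro colored_perms_comp ctransp_in_colored_perms assms) auto
qed

text \<open>
  The last factor and the product of the remaining ones are determined by
  \<open>colored_perms_peel_last_inj\<close>; the rest is induction.
\<close>

lemma sorting_factorization_unique:
  assumes "r \<ge> 1"
  shows "sorting_factorization r n \<pi> fs \<Longrightarrow> sorting_factorization r n \<pi> gs \<Longrightarrow> fs = gs"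
proof (induction n arbitrary: \<pi> fs gs)
  case 0
  then show ?case by (simp add: sorting_factorization_0)
next
  case (Suc n)
  obtain \<rho> fs' i t where 1: "sorting_factorization r n \<rho> fs'" "i \<in> {1..Suc n}" "t < r"
    "\<pi> = \<rho> \<circ> ctransp r (Suc n) i t (Suc n)"
    "fs = fs' @ (if i = Suc n \<and> t = 0 then [] else [(i, t, Suc n)])"
    using Suc.prems(1) assms by (rule sorting_factorization_unsnoc)
  obtain \<rho>' gs' i' t' where 2: "sorting_factorization r n \<rho>' gs'" "i' \<in> {1..Suc n}" "t' < r"
    "\<pi> = \<rho>' \<circ> ctransp r (Suc n) i' t' (Suc n)"
    "gs = gs' @ (if i' = Suc n \<and> t' = 0 then [] else [(i', t', Suc n)])"
    using Suc.prems(2) assms by (rule sorting_factorization_unsnoc)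
  have "\<rho> = \<rho>' \<and> i = i' \<and> t = t'"
    using 1 2 by (intro colored_perms_peel_last_inj[OF assms]
        sorting_factorization_in_colored_perms[OF assms]) auto
  moreover from this have "fs' = gs'" using 1(1) 2(1) Suc.IH by blast
  ultimately show ?case using 1(5) 2(5) by simp
qed

lemma sorting_factorization_exists:
  assumes "r \<ge> 1"
  shows "\<pi> \<in> colored_perms r n \<Longrightarrow> \<exists>fs. sorting_factorization r n \<pi> fs"
proof (induction n arbitrary: \<pi>)
  case 0
  then show ?case unfolding sorting_factorization_0 colored_perms_0 by blast
next
  case (Suc n)
  obtain \<rho> i t where it: "\<rho> \<in> colored_perms r n" "i \<in> {1..Suc n}" "t < r"
    and \<pi>: "\<pi> = \<rho> \<circ> ctransp r (Suc n) i t (Suc n)"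
    using colored_perms_peel_last[OF assms Suc.prems] by blast
  from Suc.IH[OF it(1)] obtain gs where gs: "sorting_factorization r n \<rho> gs" ..
  show ?case
  proof (cases "i = Suc n \<and> t = 0")
    case True
    then have "\<pi> = \<rho>" by (simp add: \<pi> ctransp_trivial)
    then show ?thesis using sorting_factorization_lift[OF gs] by blast
  next
    case False
    then have "i = Suc n \<longrightarrow> 0 < t" by auto
    then show ?thesis unfolding \<pi> using sorting_factorization_snoc[OF gs it(2,3)] by blast
  qed
qed

lemma sor_eq:
  assumes "r \<ge> 1" "sorting_factorization r n \<pi> fs"
  shows "sor r n \<pi> = (\<Sum>(i, t, j) \<leftarrow> fs. factor_weight i t j)"
proof -
  have "(THE fs. sorting_factorization r n \<pi> fs) = fs"
    using assms sorting_factorization_unique by blast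
  then show ?thesis by (simp add: sor_def factor_weight_def)
qed

lemma sor_0: "r \<ge> 1 \<Longrightarrow> sor r 0 id = 0"
  by (simp add: sor_eq[of r 0 id "[]"] sorting_factorization_0)

text \<open>
  The trivial factor has weight 0, so that elements fixing the last letter need no separate term.
\<close>

lemma sor_comp_ctransp:
  assumes "r \<ge> 1" "\<rho> \<in> colored_perms r n" "i \<in> {1..Suc n}" "t < r"
  shows "sor r (Suc n) (\<rho> \<circ> ctransp r (Suc n) i t (Suc n)) = sor r n \<rho> + factor_weight i t (Suc n)"
proof -
  obtain gs where gs: "sorting_factorization r n \<rho> gs"
    using sorting_factorization_exists[OF assms(1,2)] ..
  show ?thesis
  proof (cases "i = Suc n \<and> t = 0")
    case True
    then have "sor r (Suc n) (\<rho> \<circ> ctransp r (Suc n) i t (Suc n)) = sor r n \<rho>"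
      using sor_eq[OF assms(1) gs] sor_eq[OF assms(1) sorting_factorization_lift[OF gs]]
      by (simp add: ctransp_trivial)
    with True show ?thesis by (simp add: factor_weight_def)
  next
    case False
    then have "sorting_factorization r (Suc n) (\<rho> \<circ> ctransp r (Suc n) i t (Suc n))
        (gs @ [(i, t, Suc n)])"
      using assms(3,4) by (intro sorting_factorization_snoc gs) auto
    then show ?thesis
      by (simp add: sor_eq[OF assms(1)] sor_eq[OF assms(1) gs])
  qed
qed

section \<open>Length modulo two\<close>

text \<open>
  A word in the generators is a list of indices \<open>i\<close> standing for \<open>s_i\<close>. The rightmost
  generator acts first, so the head of the list acts on the result of its tail.
\<close>

primrec word_perm :: "nat list \<Rightarrow> nat \<Rightarrow> nat" where
  "word_perm [] = id"
| "word_perm (i # u) = (if i = 0 then word_perm u else transpose i (Suc i) \<circ> word_perm u)"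

text \<open>
  The number of occurrences of \<open>s_0\<close> that raise the color of the letter starting at \<open>k\<close>, that is,
  those met while the letter is in position 1. It is not reduced modulo \<open>r\<close>: the difference
  between this count and the color is what minimal words avoid.
\<close>

primrec raises :: "nat list \<Rightarrow> nat \<Rightarrow> nat" where
  "raises [] = (\<lambda>_. 0)"
| "raises (i # u) = (\<lambda>k. raises u k + (if i = 0 \<and> word_perm u k = 1 then 1 else 0))"

lemma word_perm_permutes: "set u \<subseteq> {0..<n} \<Longrightarrow> word_perm u permutes {1..n}"
  by (induction u) (auto intro!: permutes_compose permutes_swap_id permutes_id)

lemma inj_word_perm: "inj (word_perm u)"
  by (rule permutes_inj[OF word_perm_permutes[of u "Suc (Max (set u))"]])
    (auto simp: less_Suc_eq_le)

lemma cprod_word: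
  assumes "set u \<subseteq> {0..<n}"
  shows "cprod (map (simple_gen r n) u) = cperm r n (word_perm u) (raises u)"
  using assms
proof (induction u)
  case Nil
  show ?case by (simp only: list.map cprod_Nil word_perm.simps raises.simps cperm_id)
next
  case (Cons i u)
  then have p: "word_perm u permutes {1..n}" by (intro word_perm_permutes) auto
  have IH: "cprod (map (simple_gen r n) u) = cperm r n (word_perm u) (raises u)"
    using Cons by simp
  show ?case
  proof (cases "i = 0")
    case True
    have "cprod (map (simple_gen r n) (i # u))
        = cperm r n id (\<lambda>k. if k = 1 then 1 else 0) \<circ> cperm r n (word_perm u) (raises u)"
      by (simp only: list.map cprod_Cons IH simple_gen_def True simp_thms if_True)
    also have "\<dots> = cperm r n (id \<circ> word_perm u)
        (\<lambda>k. (if word_perm u k = 1 then 1 else 0) + raises u k)"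
      by (rule cperm_comp[OF p])
    also have "\<dots> = cperm r n (word_perm (i # u)) (raises (i # u))"
      by (rule cperm_cong) (use True in auto)
    finally show ?thesis .
  next
    case False
    then have "cprod (map (simple_gen r n) (i # u))
        = cperm r n (transpose i (Suc i)) (\<lambda>_. 0) \<circ> cperm r n (word_perm u) (raises u)"
      by (simp only: list.map cprod_Cons IH simple_gen_def if_False)
    also have "\<dots> = cperm r n (transpose i (Suc i) \<circ> word_perm u) (\<lambda>k. 0 + raises u k)"
      by (rule cperm_comp[OF p])
    also have "\<dots> = cperm r n (word_perm (i # u)) (raises (i # u))"
      by (rule cperm_cong) (use False in auto)
    finally show ?thesis .
  qed
qed

lemma sign_word_perm: "sign (word_perm u) = (-1) ^ length (filter (\<lambda>i. i \<noteq> 0) u)"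
proof (induction u)
  case (Cons i u)
  have "permutation (word_perm u)"
    by (rule permutes_imp_permutation[OF _ word_perm_permutes[of u "Suc (Max (set u))"]])
      (auto simp: less_Suc_eq_le)
  then have "sign (transpose i (Suc i) \<circ> word_perm u) = sign (transpose i (Suc i)) * sign (word_perm u)"
    by (intro sign_compose permutation_swap_id)
  then show ?case using Cons by (cases "i = 0") (simp_all add: sign_swap_id del: comp_apply)
qed simp

text \<open>
  At any moment exactly one letter is in position 1, so each \<open>s_0\<close> raises exactly one letter.
\<close>

lemma sum_raises:
  assumes "set u \<subseteq> {0..<n}" "n \<ge> 1"
  shows "(\<Sum>k=1..n. raises u k) = length (filter (\<lambda>i. i = 0) u)"
  using assms(1)
proof (induction u)
  case (Cons i u)
  then have p: "word_perm u permutes {1..n}" by (intro word_perm_permutes) auto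
  have "(\<Sum>k=1..n. if word_perm u k = 1 then 1 else 0) = (\<Sum>k=1..n. if k = 1 then 1 else 0 :: nat)"
    by (rule sum.permute[OF p, unfolded comp_def, symmetric])
  also have "\<dots> = 1" using assms(2) by simp
  finally have "(\<Sum>k=1..n. if word_perm u k = 1 then 1 else 0) = (1 :: nat)" .
  with Cons show ?case by (simp add: sum.distrib)
qed simp

text \<open>
  Occurrences of \<open>s_0\<close> move no letter. Deleting some of those that raise \<open>k\<close> therefore leaves
  the movement of all letters, and the raises of every other letter, as they were.
\<close>

lemma drop_raises:
  assumes "d \<le> raises u k"
  shows "\<exists>js. set js \<subseteq> set u \<and> length js + d = length u \<and> word_perm js = word_perm u \<and>
    raises js = (raises u)(k := raises u k - d)"
  using assms
proof (induction u arbitrary: d)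
  case Nil
  then show ?case by auto
next
  case (Cons i u)
  show ?case
  proof (cases "i = 0 \<and> word_perm u k = 1 \<and> d > 0")
    case True
    \<comment> \<open>The head is one of the raises of \<open>k\<close>: drop it, and \<open>d - 1\<close> further ones from the tail.\<close>
    with Cons.prems have "d - 1 \<le> raises u k" by simp
    from Cons.IH[OF this] obtain js where "set js \<subseteq> set u" "length js + (d - 1) = length u"
      "word_perm js = word_perm u" "raises js = (raises u)(k := raises u k - (d - 1))"
      by blast
    moreover have "raises (i # u) l = raises u l" if "l \<noteq> k" for l
      using injD[OF inj_word_perm, of u l k] True that by auto
    moreover have "raises (i # u) k - d = raises u k - (d - 1)" using True by simp
    ultimately show ?thesis using True
      by (intro exI[of _ js]) (auto simp: fun_eq_iff)
  next
    case False
    then have "d \<le> raises u k" using Cons.prems by (auto split: if_splits)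
    from Cons.IH[OF this] obtain js where "set js \<subseteq> set u" "length js + d = length u"
      "word_perm js = word_perm u" "raises js = (raises u)(k := raises u k - d)"
      by blast
    with False \<open>d \<le> raises u k\<close> show ?thesis
      by (intro exI[of _ "i # js"]) (auto simp: fun_eq_iff)
  qed
qed

text \<open>
  That the generators reach every colored permutation has to be known before anything can be said
  about minimal words: \<open>clength\<close> is a least element, which is only meaningful when some word
  exists.
\<close>

definition generated :: "nat \<Rightarrow> nat \<Rightarrow> cmap set" where
  "generated r n = {cprod (map (simple_gen r n) u) | u. set u \<subseteq> {0..<n}}"

lemma generated_comp:
  assumes "\<pi> \<in> generated r n" "\<rho> \<in> generated r n"
  shows "\<pi> \<circ> \<rho> \<in> generated r n"
proof -
  obtain us vs where "set us \<subseteq> {0..<n}" "\<pi> = cprod (map (simple_gen r n) us)"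
    and "set vs \<subseteq> {0..<n}" "\<rho> = cprod (map (simple_gen r n) vs)"
    using assms by (auto simp: generated_def)
  then have "\<pi> \<circ> \<rho> = cprod (map (simple_gen r n) (us @ vs))" "set (us @ vs) \<subseteq> {0..<n}"
    by (auto simp: cprod_append)
  then show ?thesis unfolding generated_def by blast
qed

lemma generated_id: "id \<in> generated r n"
  unfolding generated_def by (intro CollectI exI[of _ "[]"]) (simp add: cprod_Nil)

lemma generated_simple_gen:
  assumes "i < n"
  shows "simple_gen r n i \<in> generated r n"
  unfolding generated_def using assms
  by (intro CollectI exI[of _ "[i]"]) (simp add: cprod_Nil cprod_Cons)

text \<open>
  Conjugating \<open>(i j)\<close> by the adjacent transposition \<open>(j j+1)\<close> gives \<open>(i j+1)\<close>.
\<close>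

lemma generated_transpose:
  assumes "1 \<le> i" "i < j" "j \<le> n"
  shows "cperm r n (transpose i j) (\<lambda>_. 0) \<in> generated r n"
  using assms(2,3)
proof (induction j)
  case (Suc j)
  define adj where "adj = cperm r n (transpose j (Suc j)) (\<lambda>_. 0)"
  have adj: "adj \<in> generated r n"
    using generated_simple_gen[of j n r] Suc.prems assms(1) by (simp add: simple_gen_def adj_def)
  show ?case
  proof (cases "i = j")
    case True
    then show ?thesis using adj by (simp add: adj_def)
  next
    case False
    then have ij: "i < j" using Suc.prems by simp
    have p: "transpose j (Suc j) permutes {1..n}" "transpose i j permutes {1..n}"
      using Suc.prems ij assms(1) by (auto intro!: permutes_swap_id)
    have "transpose j (Suc j) \<circ> (transpose i j \<circ> transpose j (Suc j)) = transpose i (Suc j)"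
      using ij by (auto simp: fun_eq_iff transpose_def)
    then have "cperm r n (transpose i (Suc j)) (\<lambda>_. 0)
        = adj \<circ> (cperm r n (transpose i j) (\<lambda>_. 0) \<circ> adj)"
      by (simp add: adj_def cperm_comp p permutes_compose del: One_nat_def)
    also have "\<dots> \<in> generated r n"
      using Suc ij by (intro generated_comp adj Suc.IH) auto
    finally show ?thesis .
  qed
qed simp

lemma generated_uncolored:
  assumes "\<sigma> permutes {1..n}"
  shows "cperm r n \<sigma> (\<lambda>_. 0) \<in> generated r n"
  using assms finite_atLeastAtMost
proof (induction rule: permutes_induct)
  case id
  show ?case by (simp only: cperm_id generated_id)
next
  case (swap i j p)
  have "transpose i j = transpose (min i j) (max i j)"
    by (simp add: min_def max_def transpose_commute)
  then have "cperm r n (transpose i j) (\<lambda>_. 0) \<in> generated r n"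
    using swap(1-3) generated_transpose[of "min i j" "max i j" n r] by simp
  then have "cperm r n (transpose i j) (\<lambda>_. 0) \<circ> cperm r n p (\<lambda>_. 0) \<in> generated r n"
    using swap.IH by (rule generated_comp)
  also have "cperm r n (transpose i j) (\<lambda>_. 0) \<circ> cperm r n p (\<lambda>_. 0)
      = cperm r n (transpose i j \<circ> p) (\<lambda>_. 0)"
    using swap by (simp add: cperm_comp del: One_nat_def)
  finally show ?case .
qed

text \<open>
  To raise the color of \<open>j\<close>, carry \<open>j\<close> to position 1, apply \<open>s_0\<close> and carry it back.
\<close>

lemma generated_color:
  assumes "j \<in> {1..n}"
  shows "cperm r n id ((\<lambda>_. 0)(j := c)) \<in> generated r n"
proof (induction c)
  case 0
  have "(\<lambda>_. 0)(j := 0) = (\<lambda>_. 0 :: nat)" by auto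
  then show ?case by (simp only: cperm_id generated_id)
next
  case (Suc c)
  define s where "s = transpose 1 j"
  have s: "s permutes {1..n}" using assms by (auto simp: s_def intro!: permutes_swap_id)
  have ss: "s \<circ> s = id" by (auto simp: s_def fun_eq_iff)
  have n: "n \<ge> 1" using assms by simp
  define g where "g = simple_gen r n 0"
  have g: "g = cperm r n id (\<lambda>k. if k = 1 then 1 else 0)"
    by (simp add: g_def simple_gen_def)
  have "cperm r n s (\<lambda>_. 0) \<circ> (g \<circ> (cperm r n s (\<lambda>_. 0) \<circ> cperm r n id ((\<lambda>_. 0)(j := c))))
      = cperm r n (s \<circ> s) (\<lambda>k. (if s k = 1 then 1 else 0) + ((\<lambda>_. 0)(j := c)) k)"
    unfolding g by (simp add: cperm_comp s permutes_id permutes_compose del: One_nat_def)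
  also have "\<dots> = cperm r n id ((\<lambda>_. 0)(j := Suc c))"
    unfolding ss by (rule cperm_cong) (auto simp: s_def transpose_def split: if_splits)
  finally have "cperm r n id ((\<lambda>_. 0)(j := Suc c)) =
    cperm r n s (\<lambda>_. 0) \<circ> (g \<circ> (cperm r n s (\<lambda>_. 0) \<circ> cperm r n id ((\<lambda>_. 0)(j := c))))" ..
  moreover have "g \<in> generated r n"
    unfolding g_def by (rule generated_simple_gen) (use n in simp)
  ultimately show ?case
    by (simp only: generated_comp generated_uncolored[OF s] Suc.IH)
qed

lemma generated_diagonal: "cperm r n id z \<in> generated r n"
proof -
  have "cperm r n id (\<lambda>k. if k \<in> {1..m} then z k else 0) \<in> generated r n" if "m \<le> n" for m
    using that
  proof (induction m)
    case 0
    have "cperm r n id (\<lambda>k. if k \<in> {1..0} then z k else 0) = id"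
      by (rule trans[OF cperm_cong cperm_id]) auto
    then show ?case by (simp only: generated_id)
  next
    case (Suc m)
    have "cperm r n id ((\<lambda>_. 0)(Suc m := z (Suc m))) \<circ>
        cperm r n id (\<lambda>k. if k \<in> {1..m} then z k else 0) \<in> generated r n"
      using Suc.prems by (intro generated_comp generated_color Suc.IH) auto
    also have "cperm r n id ((\<lambda>_. 0)(Suc m := z (Suc m))) \<circ>
        cperm r n id (\<lambda>k. if k \<in> {1..m} then z k else 0)
      = cperm r n (id \<circ> id)
          (\<lambda>k. ((\<lambda>_. 0)(Suc m := z (Suc m))) (id k) + (if k \<in> {1..m} then z k else 0))"
      by (rule cperm_comp[OF permutes_id])
    also have "\<dots> = cperm r n id (\<lambda>k. if k \<in> {1..Suc m} then z k else 0)"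
      by (rule cperm_cong) (auto simp: le_Suc_eq)
    finally show ?case .
  qed
  then have "cperm r n id (\<lambda>k. if k \<in> {1..n} then z k else 0) \<in> generated r n" by blast
  also have "cperm r n id (\<lambda>k. if k \<in> {1..n} then z k else 0) = cperm r n id z"
    by (rule cperm_cong) auto
  finally show ?thesis .
qed

lemma generated_eq_colored_perms:
  assumes "r \<ge> 1"
  shows "generated r n = colored_perms r n"
proof (intro equalityI subsetI)
  fix \<pi> assume "\<pi> \<in> generated r n"
  then show "\<pi> \<in> colored_perms r n"
    unfolding generated_def
    by (auto simp: cprod_word intro!: cperm_in_colored_perms[OF assms] word_perm_permutes)
next
  fix \<pi> assume "\<pi> \<in> colored_perms r n"
  then obtain \<sigma> z where \<sigma>: "\<sigma> permutes {1..n}" and \<pi>: "\<pi> = cperm r n \<sigma> z"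
    by (rule colored_permsE)
  have "\<pi> = cperm r n \<sigma> (\<lambda>_. 0) \<circ> cperm r n id z"
    by (simp add: \<pi> cperm_comp[OF permutes_id])
  then show "\<pi> \<in> generated r n"
    by (simp only: generated_comp generated_uncolored[OF \<sigma>] generated_diagonal)
qed

lemma col_cperm:
  assumes "r \<ge> 1"
  shows "col n (cperm r n \<sigma> z) = (\<Sum>k=1..n. z k mod r)"
  unfolding col_def using assms by (intro sum.cong) (auto simp: cperm_def)

text \<open>
  A letter raised \<open>r\<close> times or more would allow \<open>drop_raises\<close> to shorten the word by \<open>r\<close>
  while keeping its product, since colors only matter modulo \<open>r\<close>.
\<close>

lemma minimal_word:
  assumes r: "r \<ge> 1" and n: "n \<ge> 1" and \<pi>: "\<pi> \<in> colored_perms r n"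
  obtains u where "set u \<subseteq> {0..<n}" "cprod (map (simple_gen r n) u) = \<pi>"
    "clength r n \<pi> = length u" "\<And>k. k \<in> {1..n} \<Longrightarrow> raises u k < r"
proof -
  let ?P = "\<lambda>m. \<exists>ws. length ws = m \<and> set ws \<subseteq> simple_gen r n ` {0..<n} \<and> cprod ws = \<pi>"
  obtain vs where "set vs \<subseteq> {0..<n}" "\<pi> = cprod (map (simple_gen r n) vs)"
    using \<pi> unfolding generated_eq_colored_perms[OF r, symmetric] generated_def by auto
  then have "?P (length vs)" by (intro exI[of _ "map (simple_gen r n) vs"]) auto
  then have "?P (clength r n \<pi>)" unfolding clength_def by (rule LeastI)
  then obtain ws where ws: "length ws = clength r n \<pi>" "set ws \<subseteq> simple_gen r n ` {0..<n}"
    "cprod ws = \<pi>" by blast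
  from ws(2) have "ws \<in> map (simple_gen r n) ` lists {0..<n}"
    by (simp only: lists_image[symmetric] in_lists_conv_set subset_eq)
  then obtain u where ws_eq: "ws = map (simple_gen r n) u" and u_sub: "set u \<subseteq> {0..<n}"
    by (auto simp: in_lists_conv_set)
  have "raises u k < r" if k: "k \<in> {1..n}" for k
  proof (rule ccontr)
    assume "\<not> raises u k < r"
    then have "r \<le> raises u k" by simp
    from drop_raises[OF this] obtain js where js: "set js \<subseteq> set u" "length js + r = length u"
      "word_perm js = word_perm u" "raises js = (raises u)(k := raises u k - r)" by blast
    have "cprod (map (simple_gen r n) js) = cperm r n (word_perm js) (raises js)"
      using js(1) u_sub by (intro cprod_word) auto
    also have "\<dots> = cperm r n (word_perm u) (raises u)"
      using js(3,4) \<open>r \<le> raises u k\<close> by (intro cperm_cong) (auto simp: le_mod_geq)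
    also have "\<dots> = \<pi>" using cprod_word[OF u_sub, of r] ws(3) ws_eq by simp
    finally have "?P (length js)"
      using js(1) u_sub by (intro exI[of _ "map (simple_gen r n) js"]) auto
    then have "clength r n \<pi> \<le> length js" unfolding clength_def by (rule Least_le)
    then show False using js(2) r ws(1) ws_eq by simp
  qed
  then show ?thesis using that[OF u_sub] ws ws_eq by simp
qed

text \<open>
  In a minimal word the raises of a letter are below \<open>r\<close> and thus equal its color, so \<open>s_0\<close>
  occurs \<open>col n \<pi>\<close> times. The remaining generators are transpositions, and their number has the parity
  of the underlying permutation.
\<close>

lemma chi_eq_sign:
  assumes r: "r \<ge> 1" and n: "n \<ge> 1" and \<pi>: "\<pi> \<in> colored_perms r n"
  shows "chi r n \<omega> a b \<pi> = of_int (sign (underlying \<pi>)) ^ a * \<omega> ^ (b * col n \<pi>)"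
proof -
  obtain u where u: "set u \<subseteq> {0..<n}" "cprod (map (simple_gen r n) u) = \<pi>"
    "clength r n \<pi> = length u" "\<And>k. k \<in> {1..n} \<Longrightarrow> raises u k < r"
    using minimal_word[OF r n \<pi>] by blast
  have \<pi>_eq: "\<pi> = cperm r n (word_perm u) (raises u)" using cprod_word[OF u(1), of r] u(2) by simp
  have "col n \<pi> = (\<Sum>k=1..n. raises u k)"
    unfolding \<pi>_eq col_cperm[OF r] using u(4) by (intro sum.cong) auto
  also have "\<dots> = length (filter (\<lambda>i. i = 0) u)" by (rule sum_raises[OF u(1) n])
  finally have "int (clength r n \<pi>) - int (col n \<pi>) = int (length (filter (\<lambda>i. i \<noteq> 0) u))"
    using sum_length_filter_compl[of "\<lambda>i. i = 0" u] u(3) by simp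
  moreover have "underlying \<pi> = word_perm u"
    unfolding \<pi>_eq by (rule underlying_cperm[OF r word_perm_permutes[OF u(1)]])
  ultimately show ?thesis
    unfolding chi_def
    by (simp add: sign_word_perm power_int_of_nat flip: of_nat_mult power_mult)
      (simp add: mult.commute)
qed

section \<open>The one-dimensional characters\<close>

definition signed_color_char :: "nat \<Rightarrow> complex \<Rightarrow> nat \<Rightarrow> nat \<Rightarrow> cmap \<Rightarrow> complex" where
  "signed_color_char n \<omega> a b \<pi> = of_int (sign (underlying \<pi>)) ^ a * \<omega> ^ (b * col n \<pi>)"

lemma power_mult_mod_order:
  fixes \<omega> :: "'a::comm_monoid_mult"
  assumes "\<omega> ^ r = 1"
  shows "\<omega> ^ (b * (m mod r)) = \<omega> ^ (b * m)"
proof -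
  have "b * m = b * (r * (m div r) + m mod r)" by (simp only: mult_div_mod_eq)
  also have "\<dots> = r * (b * (m div r)) + b * (m mod r)"
    by (simp only: add_mult_distrib2 mult.left_commute)
  finally have "b * m = r * (b * (m div r)) + b * (m mod r)" .
  then show ?thesis by (simp add: power_add power_mult[of _ r] assms)
qed

text \<open>
  Since \<open>\<omega>\<close> to the power \<open>r\<close> is 1, the colors enter only modulo \<open>r\<close>, so any unreduced coloring
  may be used to evaluate the character. This makes its multiplicativity immediate.
\<close>

lemma signed_color_char_cperm:
  assumes "r \<ge> 1" "\<omega> ^ r = 1" "\<sigma> permutes {1..n}"
  shows "signed_color_char n \<omega> a b (cperm r n \<sigma> z) = of_int (sign \<sigma>) ^ a * \<omega> ^ (b * (\<Sum>k=1..n. z k))"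
proof -
  have "\<omega> ^ (b * (\<Sum>k=1..n. z k mod r)) = \<omega> ^ (b * (\<Sum>k=1..n. z k))"
    using assms(2) by (metis mod_sum_eq power_mult_mod_order)
  then show ?thesis
    by (simp add: signed_color_char_def underlying_cperm[OF assms(1,3)] col_cperm[OF assms(1)])
qed

lemma signed_color_char_comp:
  assumes r: "r \<ge> 1" and \<omega>: "\<omega> ^ r = 1" and "\<pi> \<in> colored_perms r n" "\<rho> \<in> colored_perms r n"
  shows "signed_color_char n \<omega> a b (\<pi> \<circ> \<rho>)
    = signed_color_char n \<omega> a b \<pi> * signed_color_char n \<omega> a b \<rho>"
proof -
  obtain \<sigma> y \<tau> z where \<sigma>: "\<sigma> permutes {1..n}" and \<pi>: "\<pi> = cperm r n \<sigma> y"
    and \<tau>: "\<tau> permutes {1..n}" and \<rho>: "\<rho> = cperm r n \<tau> z"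
    using assms(3,4) by (elim colored_permsE)
  have "(\<Sum>k=1..n. y (\<tau> k)) = (\<Sum>k=1..n. y k)"
    by (rule sum.permute[OF \<tau>, unfolded comp_def, symmetric])
  moreover have "sign (\<sigma> \<circ> \<tau>) = sign \<sigma> * sign \<tau>"
    by (rule sign_compose; rule permutes_imp_permutation[OF finite_atLeastAtMost]) (fact \<sigma> \<tau>)+
  ultimately show ?thesis
    unfolding \<pi> \<rho> cperm_comp[OF \<tau>] signed_color_char_cperm[OF r \<omega> \<sigma>]
      signed_color_char_cperm[OF r \<omega> \<tau>] signed_color_char_cperm[OF r \<omega> permutes_compose[OF \<tau> \<sigma>]]
    by (simp add: sum.distrib power_mult_distrib add_mult_distrib2 power_add)
qed

lemma signed_color_char_Suc:
  assumes "\<rho> \<in> colored_perms r n"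
  shows "signed_color_char (Suc n) \<omega> a b \<rho> = signed_color_char n \<omega> a b \<rho>"
  using colored_perms_fix_outside[OF assms, of "Suc n"] by (simp add: signed_color_char_def col_def)

text \<open>
  For \<open>i\<close> below \<open>n\<close> the colors \<open>t\<close> and \<open>-t\<close> cancel and only the sign of the transposition
  remains; for \<open>i = n\<close> the permutation is trivial and only the color remains.
\<close>

lemma signed_color_char_ctransp:
  assumes r: "r \<ge> 1" and \<omega>: "\<omega> ^ r = 1" and i: "i \<in> {1..n}" and t: "t < r"
  shows "signed_color_char n \<omega> a b (ctransp r n i t n) = (if i = n then \<omega> ^ (b * t) else (-1) ^ a)"
proof -
  have s: "transpose i n permutes {1..n}" using i by (intro permutes_swap_id) auto
  let ?z = "\<lambda>k. if k = n then t else if k = i then (r - t) mod r else 0"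
  have "(\<Sum>k=1..n. ?z k) = (\<Sum>k=1..n. (if k = n then t else 0) +
      (if k = i then if i = n then 0 else (r - t) mod r else 0))"
    by (rule sum.cong) auto
  also have "\<dots> = t + (if i = n then 0 else (r - t) mod r)"
    using i by (simp add: sum.distrib)
  finally have sum_z: "(\<Sum>k=1..n. ?z k) = t + (if i = n then 0 else (r - t) mod r)" .
  have "\<omega> ^ (b * (t + (r - t) mod r)) = 1"
    using power_mult_mod_order[OF \<omega>, of b "t + (r - t) mod r"] t by (simp add: mod_add_right_eq)
  then show ?thesis
    unfolding ctransp_def signed_color_char_cperm[OF r \<omega> s] sum_z by (simp add: sign_swap_id)
qed

section \<open>The generating function\<close>

lemma sum_colored_perms_Suc:
  fixes F :: "cmap \<Rightarrow> 'a::comm_semiring_1"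
  assumes "r \<ge> 1"
    and "\<And>\<rho> i t. \<rho> \<in> colored_perms r n \<Longrightarrow> i \<in> {1..Suc n} \<Longrightarrow> t < r \<Longrightarrow>
      F (\<rho> \<circ> ctransp r (Suc n) i t (Suc n)) = G \<rho> * H i t"
  shows "(\<Sum>\<pi>\<in>colored_perms r (Suc n). F \<pi>) =
    (\<Sum>\<rho>\<in>colored_perms r n. G \<rho>) * (\<Sum>i=1..Suc n. \<Sum>t<r. H i t)"
proof -
  let ?c = "\<lambda>(\<rho>, i, t). \<rho> \<circ> ctransp r (Suc n) i t (Suc n)"
  have "(\<Sum>\<pi>\<in>colored_perms r (Suc n). F \<pi>)
      = (\<Sum>x \<in> colored_perms r n \<times> {1..Suc n} \<times> {..<r}. F (?c x))"
    by (rule sum.reindex_bij_betw[OF bij_betw_colored_perms_Suc[OF assms(1)], symmetric])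
  also have "\<dots> = (\<Sum>(\<rho>, i, t) \<in> colored_perms r n \<times> {1..Suc n} \<times> {..<r}. G \<rho> * H i t)"
  proof (rule sum.cong[OF refl])
    fix x assume "x \<in> colored_perms r n \<times> {1..Suc n} \<times> {..<r}"
    then obtain \<rho> i t where "x = (\<rho>, i, t)" "\<rho> \<in> colored_perms r n" "i \<in> {1..Suc n}" "t < r"
      by (auto elim!: SigmaE)
    then show "F (?c x) = (case x of (\<rho>, i, t) \<Rightarrow> G \<rho> * H i t)" by (simp only: prod.case assms(2))
  qed
  also have "\<dots> = (\<Sum>\<rho>\<in>colored_perms r n. \<Sum>i=1..Suc n. \<Sum>t<r. G \<rho> * H i t)"
    by (simp only: sum.cartesian_product)
  also have "\<dots> = (\<Sum>\<rho>\<in>colored_perms r n. G \<rho>) * (\<Sum>i=1..Suc n. \<Sum>t<r. H i t)"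
    by (simp only: sum_distrib_left[symmetric] sum_distrib_right[symmetric])
  finally show ?thesis .
qed

text \<open>
  Three geometric series. For \<open>i = Suc n\<close>, the weights are 0 and \<open>2 n + t\<close> with \<open>t > 0\<close>, giving
  the 1 and the term with \<open>c\<close>. For \<open>i \<le> n\<close>, color 0 contributes weights \<open>n + 1 - i\<close>, which run
  through \<open>1, ..., n\<close>; a positive color \<open>t\<close> contributes \<open>(n + 1) + (i - 1) + (t - 1)\<close>, and the sum
  splits into a product over \<open>i\<close> and \<open>t\<close>.
\<close>

lemma sum_last_factor:
  fixes \<epsilon> c q :: "'a::comm_semiring_1"
  shows "(\<Sum>i=1..Suc n. \<Sum>t<Suc p. (if i = Suc n then c ^ t else \<epsilon>) * q ^ factor_weight i t (Suc n))
    = 1 + \<epsilon> * qint n q * (q + q ^ Suc n * qint p q) + c * q ^ (2 * Suc n - 1) * qint p (c * q)"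
proof -
  let ?f = "\<lambda>i t. (if i = Suc n then c ^ t else \<epsilon>) * q ^ factor_weight i t (Suc n)"
  have last: "(\<Sum>t<Suc p. ?f (Suc n) t) = 1 + c * q ^ (2 * Suc n - 1) * qint p (c * q)"
    unfolding sum.lessThan_Suc_shift
    by (simp add: factor_weight_def qint_def sum_distrib_left power_mult_distrib power_add ac_simps)
  have step: "(\<Sum>t<Suc p. ?f (Suc i) t) = \<epsilon> * (q * q ^ (n - Suc i) + q ^ Suc n * q ^ i * qint p q)"
    if "i < n" for i
  proof -
    have "factor_weight (Suc i) 0 (Suc n) = Suc (n - Suc i)"
      using that by (simp add: factor_weight_def)
    moreover have "factor_weight (Suc i) (Suc t) (Suc n) = Suc n + i + t" for t
      using that by (simp add: factor_weight_def)
    ultimately show ?thesis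
      using that unfolding sum.lessThan_Suc_shift
      by (simp add: qint_def sum_distrib_left power_add algebra_simps)
  qed
  have "(\<Sum>i=1..n. \<Sum>t<Suc p. ?f i t)
      = (\<Sum>i<n. \<epsilon> * (q * q ^ (n - Suc i) + q ^ Suc n * q ^ i * qint p q))"
    unfolding One_nat_def sum.atLeast1_atMost_eq by (intro sum.cong refl step) simp
  also have "\<dots> = \<epsilon> * (q * (\<Sum>i<n. q ^ (n - Suc i)) + q ^ Suc n * (\<Sum>i<n. q ^ i) * qint p q)"
    by (simp only: sum_distrib_left sum_distrib_right sum.distrib distrib_left)
  also have "\<dots> = \<epsilon> * qint n q * (q + q ^ Suc n * qint p q)"
    unfolding sum.nat_diff_reindex[of "\<lambda>i. q ^ i" n] qint_def[of n, symmetric]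
    by (simp add: algebra_simps)
  finally have "(\<Sum>i=1..n. \<Sum>t<Suc p. ?f i t) = \<epsilon> * qint n q * (q + q ^ Suc n * qint p q)" .
  then show ?thesis
    unfolding sum.cl_ivl_Suc using last by (simp add: ac_simps del: sum.lessThan_Suc)
qed

lemma sor_generating_function:
  fixes q :: "complex poly"
  assumes r: "r \<ge> 1" and \<omega>: "\<omega> ^ r = 1"
  shows "(\<Sum>\<pi>\<in>colored_perms r n. [:signed_color_char n \<omega> a b \<pi>:] * q ^ sor r n \<pi>) =
    (\<Prod>k=1..n. 1 + (-1) ^ a * qint (k - 1) q * (q + q ^ k * qint (r - 1) q)
       + [:\<omega> ^ b:] * q ^ (2 * k - 1) * qint (r - 1) ([:\<omega> ^ b:] * q))"
proof (induction n)
  case 0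
  have "underlying id = id" by (simp add: underlying_def fun_eq_iff)
  then have "signed_color_char 0 \<omega> a b id = 1" by (simp only: signed_color_char_def col_def) simp
  then show ?case
    by (simp only: colored_perms_0 sum.insert[OF finite.emptyI] sum.empty empty_iff
        not_False_eq_True sor_0[OF r]) simp
next
  case (Suc n)
  obtain p where p: "r = Suc p" using r by (cases r) auto
  have minus_one: "(-1 :: complex poly) = [:-1:]" by (simp add: one_pCons)
  have sign: "[:(-1) ^ a:] = (-1 :: complex poly) ^ a"
    unfolding minus_one by (simp only: poly_const_pow)
  let ?G = "\<lambda>\<rho>. [:signed_color_char n \<omega> a b \<rho>:] * q ^ sor r n \<rho>"
  let ?H = "\<lambda>i t. (if i = Suc n then [:\<omega> ^ b:] ^ t else (-1) ^ a) * q ^ factor_weight i t (Suc n)"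
  have "(\<Sum>\<pi>\<in>colored_perms r (Suc n). [:signed_color_char (Suc n) \<omega> a b \<pi>:] * q ^ sor r (Suc n) \<pi>)
      = (\<Sum>\<rho>\<in>colored_perms r n. ?G \<rho>) * (\<Sum>i=1..Suc n. \<Sum>t<r. ?H i t)"
  proof (rule sum_colored_perms_Suc[OF r])
    fix \<rho> i t assume \<rho>: "\<rho> \<in> colored_perms r n" and i: "i \<in> {1..Suc n}" and t: "t < r"
    let ?\<tau> = "ctransp r (Suc n) i t (Suc n)"
    have "signed_color_char (Suc n) \<omega> a b (\<rho> \<circ> ?\<tau>) = signed_color_char n \<omega> a b \<rho> *
        (if i = Suc n then \<omega> ^ (b * t) else (-1) ^ a)"
      using \<rho> colored_perms_Suc_mono[OF r, of n] ctransp_in_colored_perms[OF r i, of "Suc n" t]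
      by (subst signed_color_char_comp[OF r \<omega>])
        (auto simp: signed_color_char_Suc[OF \<rho>] signed_color_char_ctransp[OF r \<omega> i t])
    also have "[:\<dots>:] = [:signed_color_char n \<omega> a b \<rho>:] *
        [:if i = Suc n then \<omega> ^ (b * t) else (-1) ^ a:]" by simp
    also have "[:if i = Suc n then \<omega> ^ (b * t) else (-1) ^ a:] =
        (if i = Suc n then [:\<omega> ^ b:] ^ t else (-1) ^ a)"
      using sign by (simp add: poly_const_pow power_mult)
    finally show "[:signed_color_char (Suc n) \<omega> a b (\<rho> \<circ> ?\<tau>):] * q ^ sor r (Suc n) (\<rho> \<circ> ?\<tau>)
        = ?G \<rho> * ?H i t"
      unfolding sor_comp_ctransp[OF r \<rho> i t] power_add by (simp only: ac_simps)
  qed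
  also have "(\<Sum>i=1..Suc n. \<Sum>t<r. ?H i t) =
      1 + (-1) ^ a * qint n q * (q + q ^ Suc n * qint p q)
        + [:\<omega> ^ b:] * q ^ (2 * Suc n - 1) * qint p ([:\<omega> ^ b:] * q)"
    unfolding p by (rule sum_last_factor)
  finally show ?case unfolding Suc.IH by (simp add: p mult.commute del: mult_pCons_left)
qed

theorem theoremB:
  fixes r n a b :: nat and \<omega> :: complex and q :: "complex poly"
  assumes "r \<ge> 1" and "n \<ge> 1"
    and "primitive_root_of_unity r \<omega>"
    and "a \<in> {0, 1}" and "b \<in> {0..r - 1}"
  defines "q \<equiv> [:0, 1:]"
  shows "(\<Sum>\<pi>\<in>colored_perms r n. [:chi r n \<omega> a b \<pi>:] * q ^ sor r n \<pi>) =
    (\<Prod>k=1..n. 1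
       + (-1) ^ a * qint (k - 1) q * (q + [:\<omega> ^ (b * r):] * q ^ k * qint (r - 1) q)
       + [:\<omega> ^ b:] * q ^ (2 * k - 1) * qint (r - 1) ([:\<omega> ^ b:] * q))"
proof -
  have \<omega>: "\<omega> ^ r = 1" using assms(3) by (simp add: primitive_root_of_unity_def)
  have "\<omega> ^ (b * r) = (\<omega> ^ r) ^ b" by (simp only: power_mult[symmetric] mult.commute)
  then have one: "[:\<omega> ^ (b * r):] = 1" using \<omega> by (simp add: one_pCons)
  have "(\<Sum>\<pi>\<in>colored_perms r n. [:chi r n \<omega> a b \<pi>:] * q ^ sor r n \<pi>)
      = (\<Sum>\<pi>\<in>colored_perms r n. [:signed_color_char n \<omega> a b \<pi>:] * q ^ sor r n \<pi>)"
    by (intro sum.cong refl) (simp only: chi_eq_sign[OF assms(1,2)] signed_color_char_def)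
  also note sor_generating_function[OF assms(1) \<omega>]
  finally show ?thesis unfolding one mult_1_left .
qed

end
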